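(* Let $\alpha_1\neq0$, $\alpha_2,\alpha_3$ be real, let $k=1/\alpha_1$, $a=\alpha_3/\alpha_1$, $b=-1-\alpha_2/\alpha_1$, and suppose $S(\alpha_1,\alpha_2,\alpha_3)=(u_n)$ is simply represented, $a\notin-\mathbb{N}$ and $a-b\notin-\mathbb{N}$. Then $$u_n\sim\frac{\Gamma(n+2a-b)}{\Gamma(a+1)\Gamma(a-b+1)\,k^{n-1}}\qquad(n\to\infty).$$ Further, the reciprocal sequence $S(\alpha_1,-2\alpha_1-\alpha_2,\alpha_1+\alpha_2+\alpha_3)$ has the same behaviour at leading order.
   Context: $\mathbb{N}=\{1,2,\dots\}$. $S(\alpha_1,\alpha_2,\alpha_3)=(u_n)_{n\ge1}$: $u_1=1$, $u_n=(\alpha_1 n+\alpha_2)u_{n-1}+\alpha_3\sum_{j=1}^{n-1}u_ju_{n-j}$, and $u_0=1/(\alpha_1+\alpha_2)$. Its generating function $f$ is the solution of the Riccati equation $f'=\beta_1f^2+(\beta_2+\beta_3/z)f+\beta_4$, $\beta_1=-\alpha_3/\alpha_1$, $\beta_2=\frac{\alpha_1+\alpha_2+2\alpha_3}{\alpha_1(\alpha_1+\alpha_2)}$, $\beta_3=1+\alpha_2/\alpha_1$, $\beta_4=-\frac{\alpha_1+\alpha_2+\alpha_3}{\alpha_1(\alpha_1+\alpha_2)^2}$, with asymptotic expansion $f(z)\sim\sum_{n\ge0}(-1)^nu_nz^{-n}$ as $|z|\to\infty$ uniformly in the sector (cut plane) on which it is single-valued (for $\alpha_1+\alpha_2=0$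 understood in the limit after removing the divergent constant). The sequence is simply represented if (i) $f$ is single-valued on $\mathbb{C}\setminus(-\infty,0]$ with no singularities there other than simple poles, and (ii) $\lim_{z\to0}zf(z)$ exists and is finite. (When $\alpha_1<0$ the role of the cut is as obtained by the scaling $S(t\alpha_1,t\alpha_2,t\alpha_3)_n=t^{n-1}S(\alpha_1,\alpha_2,\alpha_3)_n$.) *)

theory Defs
  imports "HOL-Complex_Analysis.Complex_Analysis" "HOL-Library.Landau_Symbols"
begin

text \<open>
  The sequence is indexed from 1; the value at index 0 is only the constant term of the
  generating function. For \<open>\<alpha>1 + \<alpha>2 = 0\<close> that constant diverges and is removed.
\<close>
fun S :: "real \<Rightarrow> real \<Rightarrow> real \<Rightarrow> nat \<Rightarrow> real" where
  "S \<alpha>1 \<alpha>2 \<alpha>3 0 = (if \<alpha>1 + \<alpha>2 = 0 then 0 else 1 / (\<alpha>1 + \<alpha>2))"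
| "S \<alpha>1 \<alpha>2 \<alpha>3 (Suc 0) = 1"
| "S \<alpha>1 \<alpha>2 \<alpha>3 (Suc (Suc m)) =
     (\<alpha>1 * real (Suc (Suc m)) + \<alpha>2) * S \<alpha>1 \<alpha>2 \<alpha>3 (Suc m)
     + \<alpha>3 * (\<Sum>j = 1..Suc m. S \<alpha>1 \<alpha>2 \<alpha>3 j * S \<alpha>1 \<alpha>2 \<alpha>3 (Suc (Suc m) - j))"

definition \<beta>1 :: "real \<Rightarrow> real \<Rightarrow> real \<Rightarrow> real" where
  "\<beta>1 \<alpha>1 \<alpha>2 \<alpha>3 = - \<alpha>3 / \<alpha>1"

definition \<beta>2 :: "real \<Rightarrow> real \<Rightarrow> real \<Rightarrow> real" where
  "\<beta>2 \<alpha>1 \<alpha>2 \<alpha>3 = (\<alpha>1 + \<alpha>2 + 2 * \<alpha>3) / (\<alpha>1 * (\<alpha>1 + \<alpha>2))"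

definition \<beta>3 :: "real \<Rightarrow> real \<Rightarrow> real \<Rightarrow> real" where
  "\<beta>3 \<alpha>1 \<alpha>2 \<alpha>3 = 1 + \<alpha>2 / \<alpha>1"

definition \<beta>4 :: "real \<Rightarrow> real \<Rightarrow> real \<Rightarrow> real" where
  "\<beta>4 \<alpha>1 \<alpha>2 \<alpha>3 = - (\<alpha>1 + \<alpha>2 + \<alpha>3) / (\<alpha>1 * (\<alpha>1 + \<alpha>2)\<^sup>2)"

text \<open>
  The right-hand side of the Riccati equation. The second branch is the limit, as
  \<open>\<alpha>1 + \<alpha>2\<close> tends to 0, of the equation satisfied by \<open>f - 1 / (\<alpha>1 + \<alpha>2)\<close>;
  see the lemma \<open>riccati_rhs_shift\<close> below, in which \<open>\<beta>3\<close> tends to 0.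
\<close>
definition riccati_rhs :: "real \<Rightarrow> real \<Rightarrow> real \<Rightarrow> complex \<Rightarrow> complex \<Rightarrow> complex" where
  "riccati_rhs \<alpha>1 \<alpha>2 \<alpha>3 z w =
     (if \<alpha>1 + \<alpha>2 \<noteq> 0
      then of_real (\<beta>1 \<alpha>1 \<alpha>2 \<alpha>3) * w\<^sup>2
           + (of_real (\<beta>2 \<alpha>1 \<alpha>2 \<alpha>3) + of_real (\<beta>3 \<alpha>1 \<alpha>2 \<alpha>3) / z) * w
           + of_real (\<beta>4 \<alpha>1 \<alpha>2 \<alpha>3)
      else of_real (\<beta>1 \<alpha>1 \<alpha>2 \<alpha>3) * w\<^sup>2 + of_real (1 / \<alpha>1) * w + of_real (1 / \<alpha>1) / z)"

lemma riccati_rhs_shift: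
  assumes "\<alpha>1 \<noteq> 0" "\<alpha>1 + \<alpha>2 \<noteq> 0" "z \<noteq> 0"
  shows "riccati_rhs \<alpha>1 \<alpha>2 \<alpha>3 z (of_real (1 / (\<alpha>1 + \<alpha>2)) + w) =
           of_real (\<beta>1 \<alpha>1 \<alpha>2 \<alpha>3) * w\<^sup>2
           + (of_real (1 / \<alpha>1) + of_real (\<beta>3 \<alpha>1 \<alpha>2 \<alpha>3) / z) * w + of_real (1 / \<alpha>1) / z"
proof -
  define s where "s = \<alpha>1 + \<alpha>2"
  define A C T :: complex where "A = of_real \<alpha>1" and "C = of_real \<alpha>3" and "T = of_real s"
  have nz: "A \<noteq> 0" "T \<noteq> 0"
    using assms by (simp_all add: A_def T_def s_def flip: of_real_add)
  have b: "\<beta>1 \<alpha>1 \<alpha>2 \<alpha>3 = - \<alpha>3 / \<alpha>1" "\<beta>2 \<alpha>1 \<alpha>2 \<alpha>3 = (s + 2 * \<alpha>3) / (\<alpha>1 * s)"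
    "\<beta>3 \<alpha>1 \<alpha>2 \<alpha>3 = s / \<alpha>1" "\<beta>4 \<alpha>1 \<alpha>2 \<alpha>3 = - (s + \<alpha>3) / (\<alpha>1 * s\<^sup>2)"
    using assms by (auto simp: \<beta>1_def \<beta>2_def \<beta>3_def \<beta>4_def s_def field_simps)
  have "(- C / A) * (1 / T + w)\<^sup>2 + ((T + 2 * C) / (A * T) + (T / A) / z) * (1 / T + w)
          + (- (T + C) / (A * T\<^sup>2)) =
        (- C / A) * w\<^sup>2 + (1 / A + (T / A) / z) * w + (1 / A) / z"
    using nz assms(3) by (simp add: divide_simps) (simp add: algebra_simps power2_eq_square)
  then show ?thesis
    using assms unfolding riccati_rhs_def b
    by (simp add: s_def [symmetric] A_def [symmetric] C_def [symmetric] T_def [symmetric])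
qed

text \<open>
  The complement of the nonpositive reals if \<open>\<alpha>1 > 0\<close>, and of the nonnegative reals if
  \<open>\<alpha>1 < 0\<close>: scaling the parameters by \<open>t\<close> turns \<open>f z\<close> into \<open>f (z / t) / t\<close>.
\<close>
definition cut_plane :: "real \<Rightarrow> complex set" where
  "cut_plane \<alpha>1 = {z. of_real \<alpha>1 * z \<notin> \<real>\<^sub>\<le>\<^sub>0}"

text \<open>
  The filter below makes the expansion uniform in the whole cut plane. Since the cut plane
  contains a half-plane around the ray on which \<open>exp (z / \<alpha>1)\<close> grows, at most one solution
  of the equation has this expansion. The value of \<open>f\<close> at a pole is irrelevant.
\<close>
definition generating_function ::
    "real \<Rightarrow> real \<Rightarrow> real \<Rightarrow> (complex \<Rightarrow> complex) \<Rightarrow> bool" where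
  "generating_function \<alpha>1 \<alpha>2 \<alpha>3 f \<longleftrightarrow>
     (\<forall>z \<in> cut_plane \<alpha>1. \<not> is_pole f z \<longrightarrow>
        (f has_field_derivative riccati_rhs \<alpha>1 \<alpha>2 \<alpha>3 z (f z)) (at z)) \<and>
     (\<forall>N. (\<lambda>z. f z - (\<Sum>n\<le>N. (-1) ^ n * of_real (S \<alpha>1 \<alpha>2 \<alpha>3 n) / z ^ n))
        \<in> o[inf at_infinity (principal (cut_plane \<alpha>1))](\<lambda>z. 1 / z ^ N))"

definition simply_represented :: "real \<Rightarrow> real \<Rightarrow> real \<Rightarrow> bool" where
  "simply_represented \<alpha>1 \<alpha>2 \<alpha>3 \<longleftrightarrow>
     (\<exists>f. generating_function \<alpha>1 \<alpha>2 \<alpha>3 f \<and>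
        (\<forall>z \<in> cut_plane \<alpha>1.
           f analytic_on {z} \<or>
           (isolated_singularity_at f z \<and> is_pole f z \<and> zorder f z = -1)) \<and>
        (\<exists>L. ((\<lambda>z. z * f z) \<longlongrightarrow> L) (at 0 within cut_plane \<alpha>1)))"

end

theory Submission imports Defs "HOL-Real_Asymp.Real_Asymp"
begin

text \<open>
  The proof is purely formal. Put \<open>v n = u n / \<alpha>1 ^ (n - 1)\<close>. The recurrence is a Riccati equation
  for the formal power series with coefficients \<open>v\<close>. Writing that series as \<open>X\<^sup>2 / a\<close> times the
  logarithmic derivative of \<open>X powr a * W\<close>, that is, as \<open>X + X\<^sup>2 T / W\<close>, linearises the equation;
  here \<open>W' = a T\<close> and \<open>W\<close> is the confluent series with coefficients
  \<open>pochhammer a n * pochhammer (a - b + 1) n / fact n\<close>. These coefficients grow factorially, so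
  (as in Bender's theorem) the coefficients of \<open>T / W\<close> are asymptotic to those of \<open>T\<close>, which are
  explicit quotients of Gamma functions.
\<close>

section \<open>The Riccati equation for formal power series\<close>

text \<open>At X^(m+2) the terms \<open>X^2 V'\<close> and \<open>X V\<close> together give the
  linear factor m + 2 + \<alpha>2/\<alpha>1, and \<open>V^2\<close> gives the convolution.\<close>

lemma S_eq_fps_nth:
  fixes V :: "real fps"
  assumes "\<alpha>1 \<noteq> 0"
    and riccati: "V = fps_X + fps_X ^ 2 * fps_deriv V + fps_const (1 + \<alpha>2 / \<alpha>1) * (fps_X * V)
                    + fps_const (\<alpha>3 / \<alpha>1) * V ^ 2"
    and V0: "fps_nth V 0 = 0"
  shows "S \<alpha>1 \<alpha>2 \<alpha>3 (Suc n) = \<alpha>1 ^ n * fps_nth V (Suc n)"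
proof (induction n rule: less_induct)
  case (less n)
  show ?case
  proof (cases n)
    case 0
    have "fps_nth V (Suc 0) = 1"
      by (subst riccati) (simp add: V0 power2_eq_square fps_mult_nth)
    then show ?thesis using 0 by simp
  next
    case (Suc m)
    have nth: "fps_nth V (m + 2) =
            (real m + 2 + \<alpha>2 / \<alpha>1) * fps_nth V (Suc m)
            + (\<alpha>3 / \<alpha>1) * (\<Sum>j = 1..Suc m. fps_nth V j * fps_nth V (m + 2 - j))"
    proof -
      \<comment> \<open>The recurrence omits the end indices 0 and m + 2; their products vanish by
        \<open>V0\<close>.\<close>
      have "(\<Sum>j = 0..m + 2. fps_nth V j * fps_nth V (m + 2 - j)) =
            (\<Sum>j = 1..Suc m. fps_nth V j * fps_nth V (m + 2 - j))"
        by (rule sum.mono_neutral_right) (use V0 in \<open>auto simp: not_less_eq_eq le_Suc_eq\<close>)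
      then have sq: "fps_nth (V ^ 2) (m + 2) = (\<Sum>j = 1..Suc m. fps_nth V j * fps_nth V (m + 2 - j))"
        by (simp add: power2_eq_square fps_mult_nth)
      have "fps_nth V (m + 2) = real (m + 1) * fps_nth V (Suc m)
          + (1 + \<alpha>2 / \<alpha>1) * fps_nth V (Suc m) + (\<alpha>3 / \<alpha>1) * fps_nth (V ^ 2) (m + 2)"
        by (subst riccati) (simp add: fps_X_power_mult_nth fps_X_power_mult_right_nth algebra_simps)
      then show ?thesis unfolding sq by (simp add: algebra_simps)
    qed
    have IH: "S \<alpha>1 \<alpha>2 \<alpha>3 j = \<alpha>1 ^ (j - 1) * fps_nth V j" if "j \<ge> 1" "j \<le> Suc m" for j
      using less.IH[of "j - 1"] that Suc by simp
    \<comment> \<open>The exponents add up to m only; the remaining factor of \<alpha>1^(m+1) turns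
      \<alpha>3/\<alpha>1 into \<alpha>3.\<close>
    have products: "S \<alpha>1 \<alpha>2 \<alpha>3 j * S \<alpha>1 \<alpha>2 \<alpha>3 (m + 2 - j)
            = \<alpha>1 ^ m * (fps_nth V j * fps_nth V (m + 2 - j))" if "j \<in> {1..Suc m}" for j
    proof -
      have "j - 1 + (m + 2 - j - 1) = m" using that by auto
      then have pow: "\<alpha>1 ^ (j - 1) * \<alpha>1 ^ (m + 2 - j - 1) = \<alpha>1 ^ m" by (metis power_add)
      have "S \<alpha>1 \<alpha>2 \<alpha>3 j = \<alpha>1 ^ (j - 1) * fps_nth V j"
        "S \<alpha>1 \<alpha>2 \<alpha>3 (m + 2 - j) = \<alpha>1 ^ (m + 2 - j - 1) * fps_nth V (m + 2 - j)"
        using that by (intro IH; auto)+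
      then show ?thesis unfolding pow [symmetric] by (simp only: mult_ac)
    qed
    have "S \<alpha>1 \<alpha>2 \<alpha>3 (m + 2) = (\<alpha>1 * real (m + 2) + \<alpha>2) * S \<alpha>1 \<alpha>2 \<alpha>3 (Suc m)
        + \<alpha>3 * (\<Sum>j = 1..Suc m. S \<alpha>1 \<alpha>2 \<alpha>3 j * S \<alpha>1 \<alpha>2 \<alpha>3 (m + 2 - j))"
      by (simp only: add_2_eq_Suc' S.simps)
    also have "\<dots> = (\<alpha>1 * real (m + 2) + \<alpha>2) * (\<alpha>1 ^ m * fps_nth V (Suc m))
        + \<alpha>3 * (\<Sum>j = 1..Suc m. \<alpha>1 ^ m * (fps_nth V j * fps_nth V (m + 2 - j)))"
      using IH[of "Suc m"] by (subst sum.cong[OF refl products]) simp_all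
    also have "\<dots> = \<alpha>1 ^ Suc m * fps_nth V (m + 2)"
      using \<open>\<alpha>1 \<noteq> 0\<close> unfolding nth sum_distrib_left [symmetric] by (simp add: field_simps)
    finally show ?thesis using Suc by simp
  qed
qed

text \<open>Since \<open>W' = a T\<close>, the derivative of \<open>T / W\<close> is
  \<open>T' / W - a (T / W)^2\<close>. Hence the quadratic part of \<open>X^2 V'\<close> cancels
  against that of \<open>a V^2\<close>, and what remains is the linear equation \<open>dT\<close>
  divided by \<open>W\<close>.\<close>

lemma riccati_fps_quotient:
  fixes T W :: "real fps"
  assumes W0: "fps_nth W 0 \<noteq> 0"
    and dW: "fps_deriv W = fps_const a * T"
    and dT: "T = fps_const (1 - b + a) * W + fps_const (2 - b + 2 * a) * (fps_X * T)
               + fps_X ^ 2 * fps_deriv T"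
  defines "V \<equiv> fps_X + fps_X ^ 2 * (T * inverse W)"
  shows "V = fps_X + fps_X ^ 2 * fps_deriv V + fps_const (- b) * (fps_X * V) + fps_const a * V ^ 2"
proof -
  define A B where "A = fps_const a" and "B = fps_const b"
  define I where "I = inverse W"
  have WI: "W * I = 1" using W0 by (simp add: I_def inverse_mult_eq_1')
  have dI: "fps_deriv I = - (A * T) * I ^ 2"
    using fps_inverse_deriv[OF W0] by (simp add: I_def dW A_def)
  have c: "fps_const (1 - b + a) = 1 - B + A" "fps_const (2 - b + 2 * a) = 2 - B + 2 * A"
     "fps_const (- b) = - B"
    by (simp_all add: A_def B_def numeral_fps_const
        flip: fps_const_add fps_const_sub fps_const_mult fps_const_neg)
  define D where "D = fps_deriv T"
  have T: "T = (1 - B + A) * W + (2 - B + 2 * A) * (fps_X * T) + fps_X ^ 2 * D"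
    using dT unfolding c D_def .
  have TI: "T * I = (1 - B + A) + (2 - B + 2 * A) * (fps_X * T * I) + fps_X ^ 2 * D * I"
    using T WI by algebra
  have V: "V = fps_X + fps_X ^ 2 * (T * I)" by (simp add: V_def I_def)
  have dV: "fps_deriv V = 1 + 2 * fps_X * (T * I) + fps_X ^ 2 * (D * I - A * T ^ 2 * I ^ 2)"
    unfolding V by (simp add: dI D_def power2_eq_square algebra_simps)
  show ?thesis
    unfolding dV c A_def [symmetric] unfolding V using TI by algebra
qed


section \<open>Convolutions of factorially growing sequences\<close>

text \<open>Adding the sum to its reversal under i -> n - i turns the weight i into i + (n - i) =
  n.\<close>

lemma sum_symmetric_weight:
  fixes g :: "nat \<Rightarrow> nat \<Rightarrow> real"
  assumes "\<And>i j. g i j = g j i"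
  shows "(\<Sum>i\<le>n. real i * g i (n - i)) = real n / 2 * (\<Sum>i\<le>n. g i (n - i))"
proof -
  have "(\<Sum>i\<le>n. real i * g i (n - i)) = (\<Sum>i\<le>n. real (n - i) * g i (n - i))"
    by (rule sum.reindex_bij_witness[of _ "\<lambda>i. n - i" "\<lambda>i. n - i"]) (auto simp: assms)
  then have "2 * (\<Sum>i\<le>n. real i * g i (n - i))
      = (\<Sum>i\<le>n. real i * g i (n - i) + real (n - i) * g i (n - i))"
    by (simp add: sum.distrib)
  also have "\<dots> = (\<Sum>i\<le>n. real n * g i (n - i))"
    by (intro sum.cong) (auto simp: of_nat_diff algebra_simps)
  also have "\<dots> = real n * (\<Sum>i\<le>n. g i (n - i))" by (simp add: sum_distrib_left)
  finally show ?thesis by simp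
qed

text \<open>
  Splitting off one factor \<open>\<rho> i \<approx> i\<close> and symmetrising gives the self-convolution at \<open>n + 1\<close> a
  factor of about \<open>n / 2\<close> times the one at \<open>n\<close>, whereas \<open>t\<close> itself grows by about \<open>n\<close>; so the ratio
  of the two satisfies a contractive recursion.
\<close>
lemma factorial_growth_self_convolution:
  fixes t \<rho> :: "nat \<Rightarrow> real"
  assumes rec: "\<And>n. t (Suc n) = \<rho> n * t n"
    and nz: "\<And>n. t n \<noteq> 0"
    and \<rho>: "\<And>n. \<bar>\<rho> n - real n\<bar> \<le> c"
  obtains C where "C \<ge> 0" "\<And>n. (\<Sum>i\<le>n. \<bar>t i\<bar> * \<bar>t (n - i)\<bar>) \<le> C * \<bar>t n\<bar>"
proof -
  define D where "D n = (\<Sum>i\<le>n. \<bar>t i\<bar> * \<bar>t (n - i)\<bar>)" for n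
  have "c \<ge> 0" using \<rho>[of 0] by linarith
  have D_nonneg: "D n \<ge> 0" for n unfolding D_def by (intro sum_nonneg) auto
  have D_Suc: "D (Suc n) \<le> \<bar>t 0\<bar> * \<bar>t (Suc n)\<bar> + (real n / 2 + c) * D n" for n
  proof -
    have "D (Suc n) = \<bar>t 0\<bar> * \<bar>t (Suc n)\<bar> + (\<Sum>i\<le>n. \<bar>\<rho> i\<bar> * (\<bar>t i\<bar> * \<bar>t (n - i)\<bar>))"
      unfolding D_def by (subst sum.atMost_Suc_shift) (simp add: rec abs_mult mult.assoc)
    also have "(\<Sum>i\<le>n. \<bar>\<rho> i\<bar> * (\<bar>t i\<bar> * \<bar>t (n - i)\<bar>))
        \<le> (\<Sum>i\<le>n. (real i + c) * (\<bar>t i\<bar> * \<bar>t (n - i)\<bar>))"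
    proof (intro sum_mono mult_right_mono)
      show "\<bar>\<rho> i\<bar> \<le> real i + c" for i using \<rho>[of i] by linarith
    qed simp
    also have "\<dots> = (real n / 2 + c) * D n"
      using sum_symmetric_weight[of "\<lambda>i j. \<bar>t i\<bar> * \<bar>t j\<bar>" n]
      by (simp add: distrib_right sum.distrib D_def mult.commute flip: sum_distrib_left)
    finally show ?thesis by simp
  qed
  \<comment> \<open>For n >= 7c one has n/2 + c \<le> 3/4 (n - c) \<le> 3/4
    \<open>|\<rho> n|\<close>, so beyond \<open>N\<close> the recursion contracts by 3/4.\<close>
  define N where "N = nat \<lceil>7 * c\<rceil>"
  \<comment> \<open>The summand \<open>4 * |t 0|\<close> makes \<open>|t 0| + 3/4 * C\<close> at
    most \<open>C\<close>; the finite sum dominates the ratios up to \<open>N\<close>.\<close>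
  define C where "C = 4 * \<bar>t 0\<bar> + (\<Sum>n\<le>N. D n / \<bar>t n\<bar>)"
  have C_nonneg: "C \<ge> 0"
    unfolding C_def using D_nonneg by (intro add_nonneg_nonneg sum_nonneg) auto
  have C_ge: "4 * \<bar>t 0\<bar> \<le> C"
    unfolding C_def using D_nonneg by (simp add: sum_nonneg)
  have "D n \<le> C * \<bar>t n\<bar>" for n
  proof (induction n)
    case 0
    have "D 0 = \<bar>t 0\<bar> * \<bar>t 0\<bar>" by (simp add: D_def)
    also have "\<dots> \<le> C * \<bar>t 0\<bar>" using C_ge by (intro mult_right_mono) auto
    finally show ?case .
  next
    case (Suc n)
    show ?case
    proof (cases "Suc n \<le> N")
      case True
      then have "D (Suc n) / \<bar>t (Suc n)\<bar> \<le> (\<Sum>n\<le>N. D n / \<bar>t n\<bar>)"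
        using D_nonneg by (intro member_le_sum) auto
      then have "D (Suc n) / \<bar>t (Suc n)\<bar> \<le> C" unfolding C_def by simp
      then show ?thesis using nz[of "Suc n"] by (simp add: pos_divide_le_eq)
    next
      case False
      then have n: "real n \<ge> 7 * c" unfolding N_def by linarith
      have "(real n / 2 + c) * D n \<le> (real n / 2 + c) * (C * \<bar>t n\<bar>)"
        using Suc \<open>c \<ge> 0\<close> by (intro mult_left_mono) auto
      also have "\<dots> = C * ((real n / 2 + c) * \<bar>t n\<bar>)" by simp
      also have "\<dots> \<le> C * (3 / 4 * \<bar>\<rho> n\<bar> * \<bar>t n\<bar>)"
      proof (intro mult_left_mono mult_right_mono)
        show "real n / 2 + c \<le> 3 / 4 * \<bar>\<rho> n\<bar>" using \<rho>[of n] n by linarith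
      qed (use C_nonneg in auto)
      also have "\<dots> = 3 / 4 * C * \<bar>t (Suc n)\<bar>" by (simp add: rec abs_mult)
      finally have "D (Suc n) \<le> \<bar>t 0\<bar> * \<bar>t (Suc n)\<bar> + 3 / 4 * C * \<bar>t (Suc n)\<bar>"
        using D_Suc[of n] by linarith
      also have "\<dots> = (\<bar>t 0\<bar> + 3 / 4 * C) * \<bar>t (Suc n)\<bar>" by (simp add: algebra_simps)
      also have "\<dots> \<le> C * \<bar>t (Suc n)\<bar>"
        using C_ge by (intro mult_right_mono) auto
      finally show ?thesis .
    qed
  qed
  then show ?thesis using that C_nonneg unfolding D_def by blast
qed

text \<open>Bootstrapping: the self-convolution bound first yields r = O(t) by induction. Fed back
  into the hypothesis on \<open>r\<close>, this bounds the error at n + 1 by O(\<open>t n\<close>),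
  smaller than \<open>t (Suc n)\<close> by a factor of order n.\<close>

lemma factorial_growth_perturbation:
  fixes r t \<rho> :: "nat \<Rightarrow> real"
  assumes rec: "\<And>n. t (Suc n) = \<rho> n * t n"
    and nz: "\<And>n. t n \<noteq> 0"
    and \<rho>: "\<And>n. \<bar>\<rho> n - real n\<bar> \<le> c"
    and r: "\<And>n. \<bar>r (Suc n) - t (Suc n)\<bar> \<le> A * (\<Sum>i\<le>n. \<bar>t i\<bar> * \<bar>r (n - i)\<bar>)"
    and "A \<ge> 0"
  shows "r \<sim>[at_top] t"
proof -
  obtain C where "C \<ge> 0" and C: "\<And>n. (\<Sum>i\<le>n. \<bar>t i\<bar> * \<bar>t (n - i)\<bar>) \<le> C * \<bar>t n\<bar>"
    using factorial_growth_self_convolution[OF rec nz \<rho>] by blast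
  \<comment> \<open>A bound M up to n controls the next error; the gain 1/(n - c) comes from
    \<open>|\<rho> n|\<close> >= n - c.\<close>
  have step: "\<bar>r (Suc n) - t (Suc n)\<bar> \<le> A * C * M / (real n - c) * \<bar>t (Suc n)\<bar>"
    if M: "\<And>m. m \<le> n \<Longrightarrow> \<bar>r m\<bar> \<le> M * \<bar>t m\<bar>" and n: "real n > c" for n M
  proof -
    have "0 \<le> M * \<bar>t 0\<bar>" using M[of 0] abs_ge_zero[of "r 0"] by linarith
    then have "M \<ge> 0" using nz[of 0] by (simp add: zero_le_mult_iff)
    have "(\<Sum>i\<le>n. \<bar>t i\<bar> * \<bar>r (n - i)\<bar>) \<le> (\<Sum>i\<le>n. \<bar>t i\<bar> * (M * \<bar>t (n - i)\<bar>))"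
      using M by (intro sum_mono mult_left_mono) auto
    also have "\<dots> = M * (\<Sum>i\<le>n. \<bar>t i\<bar> * \<bar>t (n - i)\<bar>)"
      by (simp add: sum_distrib_left algebra_simps)
    also have "\<dots> \<le> M * (C * \<bar>t n\<bar>)" using C \<open>M \<ge> 0\<close> by (intro mult_left_mono)
    finally have "A * (\<Sum>i\<le>n. \<bar>t i\<bar> * \<bar>r (n - i)\<bar>) \<le> A * (M * (C * \<bar>t n\<bar>))"
      using \<open>A \<ge> 0\<close> by (rule mult_left_mono)
    also have "\<dots> = A * C * M * \<bar>t n\<bar>" by simp
    also have "\<dots> \<le> A * C * M * (\<bar>t (Suc n)\<bar> / (real n - c))"
    proof (rule mult_left_mono)
      have "(real n - c) * \<bar>t n\<bar> \<le> \<bar>\<rho> n\<bar> * \<bar>t n\<bar>"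
        using \<rho>[of n] by (intro mult_right_mono) linarith+
      then show "\<bar>t n\<bar> \<le> \<bar>t (Suc n)\<bar> / (real n - c)"
        using n by (simp add: rec abs_mult field_simps)
    qed (use \<open>A \<ge> 0\<close> \<open>C \<ge> 0\<close> \<open>M \<ge> 0\<close> in simp)
    finally show ?thesis using r[of n] by simp
  qed
  \<comment> \<open>For m >= \<open>N\<close>, m - c exceeds 2AC, so the relative error is at most
    M/2; the induction closes because M >= 2 gives 1 + M/2 \<le> M.\<close>
  define N where "N = nat \<lceil>c + 1 + 2 * A * C\<rceil>"
  define M where "M = 2 + (\<Sum>n\<le>N. \<bar>r n\<bar> / \<bar>t n\<bar>)"
  have "M \<ge> 2" unfolding M_def by (simp add: sum_nonneg)
  have M: "\<bar>r n\<bar> \<le> M * \<bar>t n\<bar>" for n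
  proof (induction n rule: less_induct)
    case (less n)
    show ?case
    proof (cases "n \<le> N")
      case True
      then have "\<bar>r n\<bar> / \<bar>t n\<bar> \<le> (\<Sum>n\<le>N. \<bar>r n\<bar> / \<bar>t n\<bar>)"
        by (intro member_le_sum) auto
      then have "\<bar>r n\<bar> / \<bar>t n\<bar> \<le> M" unfolding M_def by simp
      then show ?thesis using nz[of n] by (simp add: pos_divide_le_eq)
    next
      case False
      then obtain m where m: "n = Suc m" by (cases n) auto
      have "m \<ge> N" using False m by simp
      then have large: "real m \<ge> c + 1 + 2 * A * C" unfolding N_def by linarith
      moreover have "0 \<le> A * C" using \<open>A \<ge> 0\<close> \<open>C \<ge> 0\<close> by simp
      ultimately have "real m > c" by linarith
      have "A * C / (real m - c) \<le> 1 / 2"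
        using large \<open>real m > c\<close> by (simp add: field_simps)
      then have "M * (A * C / (real m - c)) \<le> M * (1 / 2)"
        using \<open>M \<ge> 2\<close> by (intro mult_left_mono) auto
      then have "A * C * M / (real m - c) \<le> M / 2" by (simp add: mult.commute)
      then have "A * C * M / (real m - c) * \<bar>t n\<bar> \<le> M / 2 * \<bar>t n\<bar>"
        by (rule mult_right_mono) simp
      moreover have "\<bar>r n - t n\<bar> \<le> A * C * M / (real m - c) * \<bar>t n\<bar>"
        using step[of m M] less.IH \<open>real m > c\<close> m by auto
      ultimately have "\<bar>r n\<bar> \<le> \<bar>t n\<bar> + M / 2 * \<bar>t n\<bar>" by linarith
      also have "\<dots> = (1 + M / 2) * \<bar>t n\<bar>" by (simp add: algebra_simps)
      also have "\<dots> \<le> M * \<bar>t n\<bar>" using \<open>M \<ge> 2\<close> by (intro mult_right_mono) auto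
      finally show ?thesis .
    qed
  qed
  \<comment> \<open>With \<open>M\<close> valid at every index, \<open>step\<close> makes the
    relative error O(1/n).\<close>
  have "(\<lambda>n. r (Suc n) / t (Suc n) - 1) \<longlonglongrightarrow> 0"
  proof (rule Lim_null_comparison)
    show "\<forall>\<^sub>F n in sequentially. norm (r (Suc n) / t (Suc n) - 1) \<le> A * C * M / (real n - c)"
      using eventually_gt_at_top[of "nat \<lceil>c\<rceil>"]
    proof eventually_elim
      case (elim n)
      then have "real n > c" by linarith
      have "norm (r (Suc n) / t (Suc n) - 1) = \<bar>r (Suc n) - t (Suc n)\<bar> / \<bar>t (Suc n)\<bar>"
        using nz[of "Suc n"] by (simp add: field_simps flip: abs_divide)
      also have "\<dots> \<le> A * C * M / (real n - c)"
        using step[of n M] M \<open>real n > c\<close> nz[of "Suc n"] by (simp add: pos_divide_le_eq)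
      finally show ?case .
    qed
    show "(\<lambda>n. A * C * M / (real n - c)) \<longlonglongrightarrow> 0" by real_asymp
  qed
  then have "(\<lambda>n. r (Suc n) / t (Suc n)) \<longlonglongrightarrow> 1"
    by (simp add: LIM_zero_iff)
  then have "(\<lambda>n. r n / t n) \<longlonglongrightarrow> 1" by (rule LIMSEQ_imp_Suc)
  then show ?thesis by (rule asymp_equivI')
qed


section \<open>Asymptotics of the Gamma function and of Pochhammer products\<close>

text \<open>Euler's limit for 1/Gamma settles shifts above 1. Smaller shifts follow by descent with
  Gamma(y + 1) = y Gamma(y), each step dividing by about n.\<close>

lemma Gamma_add_asymp_equiv:
  fixes s :: real
  shows "(\<lambda>n. Gamma (real n + s)) \<sim>[at_top] (\<lambda>n. fact n * real n powr (s - 1))"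
proof -
  have base: "(\<lambda>n. Gamma (real n + (s + 1))) \<sim>[at_top] (\<lambda>n. fact n * real n powr s)" if "s > 0" for s :: real
  proof -
    have s: "s \<notin> \<int>\<^sub>\<le>\<^sub>0" using that nonpos_Ints_nonpos by fastforce
    have "(\<lambda>n. rGamma_series s n * Gamma s) \<longlonglongrightarrow> rGamma s * Gamma s"
      by (intro tendsto_intros)
    moreover have "rGamma s * Gamma s = 1"
      using Gamma_real_pos[OF that] by (simp add: rGamma_inverse_Gamma)
    ultimately have lim: "(\<lambda>n. rGamma_series s n * Gamma s) \<longlonglongrightarrow> 1" by simp
    show ?thesis
    proof (rule asymp_equivI', rule Lim_transform_eventually[OF lim])
      show "\<forall>\<^sub>F n in sequentially. rGamma_series s n * Gamma s =
              Gamma (real n + (s + 1)) / (fact n * real n powr s)"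
        using eventually_gt_at_top[of 0]
      proof eventually_elim
        case (elim n)
        have "pochhammer s (n + 1) * Gamma s = Gamma (real n + (s + 1))"
          using pochhammer_Gamma[OF s, of "n + 1"] Gamma_real_pos[OF that] by (simp add: add_ac)
        then show ?case using elim by (simp add: rGamma_series_def powr_def)
      qed
    qed
  qed
  have "(\<lambda>n. Gamma (real n + (s - real m))) \<sim>[at_top] (\<lambda>n. fact n * real n powr (s - real m - 1))"
    if "s > 1" for m and s :: real
  proof (induction m)
    case 0
    show ?case using base[of "s - 1"] that by simp
  next
    case (Suc m)
    have "(\<lambda>n. Gamma (real n + (s - real m)) / (real n + (s - real (Suc m))))
        \<sim>[at_top] (\<lambda>n. (fact n * real n powr (s - real m - 1)) / real n)"
      by (intro asymp_equiv_intros Suc) real_asymp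
    moreover have "\<forall>\<^sub>F n in at_top. Gamma (real n + (s - real m)) / (real n + (s - real (Suc m)))
       = Gamma (real n + (s - real (Suc m)))"
      \<comment> \<open>n > m and s > 1 keep \<open>y\<close> positive, away from the poles of
        Gamma.\<close>
      using eventually_gt_at_top[of m]
    proof eventually_elim
      case (elim n)
      define y where "y = real n + (s - real (Suc m))"
      have "y > 0" using elim \<open>s > 1\<close> unfolding y_def by linarith
      then have "y \<notin> \<int>\<^sub>\<le>\<^sub>0" using nonpos_Ints_nonpos by fastforce
      then have "Gamma (y + 1) = y * Gamma y" by (rule Gamma_plus1)
      moreover have "y + 1 = real n + (s - real m)" by (simp add: y_def)
      ultimately have "Gamma (real n + (s - real m)) / y = Gamma y" using \<open>y > 0\<close> by simp
      then show ?case unfolding y_def .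
    qed
    moreover have "\<forall>\<^sub>F n in at_top. (fact n * real n powr (s - real m - 1)) / real n
        = fact n * real n powr (s - real (Suc m) - 1)"
      using eventually_gt_at_top[of 0]
      by eventually_elim (simp add: powr_diff power2_eq_square)
    ultimately show ?case by (rule asymp_equiv_transfer)
  qed
  \<comment> \<open>This many unit steps up bring s to at least 2, where the descent may
    start.\<close>
  from this[of "s + real (nat \<lceil>2 - s\<rceil>)" "nat \<lceil>2 - s\<rceil>"]
  have "s + real (nat \<lceil>2 - s\<rceil>) > 1 \<Longrightarrow> ?thesis" by simp
  moreover have "s + real (nat \<lceil>2 - s\<rceil>) > 1" by linarith
  ultimately show ?thesis by blast
qed

text \<open>Each Pochhammer symbol is a Gamma quotient. One factorial cancels, and the exponents x -
  1 and y (the latter from \<open>Suc n\<close>) add up to x + y - 1, the exponent belonging to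
  Gamma(n + x + y).\<close>

lemma pochhammer_product_asymp_equiv:
  fixes x y :: real
  assumes "x \<notin> \<int>\<^sub>\<le>\<^sub>0" "y \<notin> \<int>\<^sub>\<le>\<^sub>0"
  shows "(\<lambda>n. pochhammer x n * pochhammer y (Suc n) / fact n)
           \<sim>[at_top] (\<lambda>n. Gamma (real n + (x + y)) / (Gamma x * Gamma y))"
proof -
  have "(\<lambda>n. Gamma (real n + x) * Gamma (real n + (y + 1)) / fact n / (Gamma x * Gamma y))
     \<sim>[at_top] (\<lambda>n. (fact n * real n powr (x - 1)) * (fact n * real n powr (y + 1 - 1))
                       / fact n / (Gamma x * Gamma y))"
    by (intro asymp_equiv_intros Gamma_add_asymp_equiv)
  also have "(\<lambda>n. (fact n * real n powr (x - 1)) * (fact n * real n powr (y + 1 - 1)) / fact n / (Gamma x * Gamma y))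
      = (\<lambda>n. fact n * real n powr (x + y - 1) / (Gamma x * Gamma y))"
    by (simp add: fun_eq_iff flip: powr_add) (simp add: add_diff_eq add.commute diff_add_eq)
  also have "\<dots> \<sim>[at_top] (\<lambda>n. Gamma (real n + (x + y)) / (Gamma x * Gamma y))"
    using Gamma_add_asymp_equiv[of "x + y"]
    by (intro asymp_equiv_divide asymp_equiv_refl) (simp add: asymp_equiv_sym)
  finally show ?thesis
    using assms by (simp add: pochhammer_Gamma add_ac mult_ac)
qed

section \<open>Asymptotics of the sequence\<close>

lemma S_asymp_equiv:
  fixes \<alpha>1 \<alpha>2 \<alpha>3 a b :: real
  assumes "\<alpha>1 \<noteq> 0"
    and a: "a = \<alpha>3 / \<alpha>1" and b: "b = - 1 - \<alpha>2 / \<alpha>1"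
    and a_nonpole: "a + 1 \<notin> \<int>\<^sub>\<le>\<^sub>0" and ab_nonpole: "a - b + 1 \<notin> \<int>\<^sub>\<le>\<^sub>0"
  shows "S \<alpha>1 \<alpha>2 \<alpha>3 \<sim>[at_top]
           (\<lambda>n. \<alpha>1 ^ (n - 1) * (Gamma (real n + (2 * a - b)) / (Gamma (a + 1) * Gamma (a - b + 1))))"
proof -
  \<comment> \<open>Defining \<open>t\<close> directly, and not as the coefficients of
    \<open>W' / a\<close>, includes the case a = 0.\<close>
  define t where "t n = pochhammer (a + 1) n * pochhammer (a - b + 1) (Suc n) / fact n" for n
  define w where "w n = pochhammer a n * pochhammer (a - b + 1) n / fact n" for n
  define \<rho> where "\<rho> n = (real n + a + 1) * (real n + a - b + 2) / (real n + 1)" for n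
  define W T where "W = Abs_fps w" and "T = Abs_fps t"
  define R where "R = T * inverse W"
  define V where "V = fps_X + fps_X ^ 2 * R"
  have W0: "fps_nth W 0 = 1" by (simp add: W_def w_def)
  have t_Suc: "t (Suc n) = \<rho> n * t n" for n
    by (simp add: t_def \<rho>_def pochhammer_Suc field_simps)
  \<comment> \<open>A Pochhammer symbol can vanish only if its base is a nonpositive
    integer.\<close>
  have t_nz: "t n \<noteq> 0" for n
    using a_nonpole ab_nonpole unfolding t_def
    by (auto simp: pochhammer_eq_0_iff)
  have w_Suc: "real (Suc n) * w (Suc n) = a * t n" for n
  proof -
    have "w (Suc n) = a * pochhammer (a + 1) n * pochhammer (a - b + 1) (Suc n) / (real (Suc n) * fact n)"
      unfolding w_def pochhammer_rec[of a] fact_Suc by simp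
    then show ?thesis unfolding t_def by simp
  qed
  have \<rho>_eq: "\<rho> n - real n = 2 * a - b + 2 + a * (a - b + 1) / (real n + 1)" for n
    by (simp add: \<rho>_def field_simps)
  \<comment> \<open>The last summand is (a - b + 1) \<open>w (Suc n)\<close>, so this is coefficient
    n + 1 of \<open>dT\<close>.\<close>
  have t_Suc': "t (Suc n) = (real n + 2 * a - b + 2) * t n + (a - b + 1) * (a * t n / (real n + 1))" for n
    by (simp add: t_Suc \<rho>_def field_simps)
  have \<rho>: "\<bar>\<rho> n - real n\<bar> \<le> \<bar>2 * a - b + 2\<bar> + \<bar>a * (a - b + 1)\<bar>" for n
  proof -
    have "\<bar>a * (a - b + 1) / (real n + 1)\<bar> \<le> \<bar>a * (a - b + 1)\<bar> / 1"
      unfolding abs_divide by (intro divide_left_mono) auto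
    then show ?thesis unfolding \<rho>_eq by linarith
  qed
  have dW: "fps_deriv W = fps_const a * T"
    using w_Suc by (intro fps_ext) (simp add: W_def T_def)
  \<comment> \<open>Together with \<open>dW\<close> this is the hypergeometric equation of 2F0(a, a
    - b + 1) as a first-order system.\<close>
  have dT: "T = fps_const (1 - b + a) * W + fps_const (2 - b + 2 * a) * (fps_X * T)
               + fps_X ^ 2 * fps_deriv T"
  proof (rule fps_ext)
    fix n
    show "fps_nth T n = fps_nth (fps_const (1 - b + a) * W
        + fps_const (2 - b + 2 * a) * (fps_X * T) + fps_X ^ 2 * fps_deriv T) n"
    proof (cases n)
      case 0
      then show ?thesis by (simp add: T_def W_def t_def w_def)
    next
      case (Suc m)
      have "w (Suc m) = a * t m / (real m + 1)"
        using w_Suc[of m] by (simp add: field_simps)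
      moreover have "fps_nth (fps_X ^ 2 * fps_deriv T) (Suc m) = real m * t m"
        by (cases m) (simp_all add: fps_X_power_mult_nth T_def)
      ultimately show ?thesis
        using Suc by (simp add: T_def W_def t_Suc') (simp add: algebra_simps add_divide_distrib diff_divide_distrib)
    qed
  qed
  \<comment> \<open>In \<open>V\<close> the term X carries u_1 = 1 and X^2 shifts \<open>R\<close>,
    hence the offset 2; -b is the coefficient 1 + \<alpha>2/\<alpha>1.\<close>
  have S_R: "S \<alpha>1 \<alpha>2 \<alpha>3 (n + 2) = \<alpha>1 ^ (n + 1) * fps_nth R n" for n
  proof -
    have "V = fps_X + fps_X ^ 2 * fps_deriv V + fps_const (- b) * (fps_X * V) + fps_const a * V ^ 2"
      using riccati_fps_quotient[OF _ dW dT] W0 unfolding V_def R_def by simp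
    then have "S \<alpha>1 \<alpha>2 \<alpha>3 (Suc (Suc n)) = \<alpha>1 ^ Suc n * fps_nth V (Suc (Suc n))"
      using \<open>\<alpha>1 \<noteq> 0\<close> by (intro S_eq_fps_nth) (simp_all add: a b V_def add.commute)
    then show ?thesis by (simp add: V_def fps_X_power_mult_nth)
  qed
  have conv: "R * W = T"
    unfolding R_def using W0 by (simp add: mult.assoc inverse_mult_eq_1)
  have "fps_nth R \<sim>[at_top] t"
  proof (rule factorial_growth_perturbation[OF t_Suc t_nz \<rho>])
    fix n
    \<comment> \<open>Splitting off \<open>w 0 = 1\<close> leaves the difference as a convolution of
      \<open>R\<close> with the tail of \<open>w\<close>.\<close>
    have "t (Suc n) = fps_nth (W * R) (Suc n)" using conv by (simp add: T_def mult.commute)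
    also have "\<dots> = fps_nth R (Suc n) + (\<Sum>i\<le>n. w (Suc i) * fps_nth R (n - i))"
      using W0 by (simp add: fps_mult_nth atMost_atLeast0 [symmetric] sum.atMost_Suc_shift W_def del: sum.atMost_Suc)
    finally have "\<bar>fps_nth R (Suc n) - t (Suc n)\<bar> = \<bar>\<Sum>i\<le>n. w (Suc i) * fps_nth R (n - i)\<bar>"
      by simp
    also have "\<dots> \<le> (\<Sum>i\<le>n. \<bar>w (Suc i) * fps_nth R (n - i)\<bar>)" by (rule sum_abs)
    also have "\<dots> \<le> (\<Sum>i\<le>n. \<bar>a\<bar> * (\<bar>t i\<bar> * \<bar>fps_nth R (n - i)\<bar>))"
    proof (rule sum_mono)
      fix i
      \<comment> \<open>Giving up the factor 1/(i + 1) in \<open>w (Suc i)\<close> still leaves the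
        bound \<open>|a| * |t i|\<close>.\<close>
      have "\<bar>w (Suc i)\<bar> \<le> real (Suc i) * \<bar>w (Suc i)\<bar>" by (simp add: algebra_simps)
      also have "\<dots> = \<bar>a\<bar> * \<bar>t i\<bar>"
        using w_Suc[of i] by (metis abs_mult abs_of_nat)
      finally show "\<bar>w (Suc i) * fps_nth R (n - i)\<bar> \<le> \<bar>a\<bar> * (\<bar>t i\<bar> * \<bar>fps_nth R (n - i)\<bar>)"
        unfolding abs_mult mult.assoc [symmetric] by (rule mult_right_mono) simp
    qed
    finally show "\<bar>fps_nth R (Suc n) - t (Suc n)\<bar> \<le> \<bar>a\<bar> * (\<Sum>i\<le>n. \<bar>t i\<bar> * \<bar>fps_nth R (n - i)\<bar>)"
      by (simp add: sum_distrib_left)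
  qed simp
  also have "t \<sim>[at_top] (\<lambda>n. Gamma (real n + (a + 1 + (a - b + 1))) / (Gamma (a + 1) * Gamma (a - b + 1)))"
    unfolding t_def using a_nonpole ab_nonpole by (rule pochhammer_product_asymp_equiv)
  finally have "(\<lambda>n. \<alpha>1 ^ (n + 1) * fps_nth R n) \<sim>[at_top]
      (\<lambda>n. \<alpha>1 ^ (n + 1) * (Gamma (real n + (a + 1 + (a - b + 1))) / (Gamma (a + 1) * Gamma (a - b + 1))))"
    by (intro asymp_equiv_intros)
  \<comment> \<open>(a + 1) + (a - b + 1) = 2 + (2a - b), and the 2 joins n to form the index n +
    2.\<close>
  then have shifted: "(\<lambda>n. S \<alpha>1 \<alpha>2 \<alpha>3 (n + 2)) \<sim>[at_top]
      (\<lambda>n. \<alpha>1 ^ (n + 2 - 1) * (Gamma (real (n + 2) + (2 * a - b)) / (Gamma (a + 1) * Gamma (a - b + 1))))"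
    unfolding S_R by (simp add: algebra_simps)
  \<comment> \<open>Composing with n - 2 undoes the shift; truncation affects only n < 2.\<close>
  have "filterlim (\<lambda>n::nat. n - 2) at_top at_top" by (rule filterlim_minus_const_nat_at_top)
  from asymp_equiv_compose'[OF shifted this] show ?thesis
  proof (rule asymp_equiv_transfer)
    have "\<forall>\<^sub>F n :: nat in at_top. n - 2 + 2 = n"
      using eventually_ge_at_top[of 2] by eventually_elim simp
    then show "\<forall>\<^sub>F n in at_top. S \<alpha>1 \<alpha>2 \<alpha>3 (n - 2 + 2) = S \<alpha>1 \<alpha>2 \<alpha>3 n"
      and "\<forall>\<^sub>F n in at_top. \<alpha>1 ^ (n - 2 + 2 - 1) * (Gamma (real (n - 2 + 2) + (2 * a - b))
              / (Gamma (a + 1) * Gamma (a - b + 1)))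
           = \<alpha>1 ^ (n - 1) * (Gamma (real n + (2 * a - b)) / (Gamma (a + 1) * Gamma (a - b + 1)))"
      by (eventually_elim, simp only:)+
  qed
qed

theorem mainTheorem6:
  fixes \<alpha>1 \<alpha>2 \<alpha>3 k a b :: real
  assumes "\<alpha>1 \<noteq> 0"
    and "k = 1 / \<alpha>1"
    and "a = \<alpha>3 / \<alpha>1"
    and "b = - 1 - \<alpha>2 / \<alpha>1"
    and "simply_represented \<alpha>1 \<alpha>2 \<alpha>3"
    and "\<forall>m::nat. m \<ge> 1 \<longrightarrow> a \<noteq> - real m"
    and "\<forall>m::nat. m \<ge> 1 \<longrightarrow> a - b \<noteq> - real m"
  shows "S \<alpha>1 \<alpha>2 \<alpha>3 \<sim>[at_top]
           (\<lambda>n. Gamma (real n + 2 * a - b) / (Gamma (a + 1) * Gamma (a - b + 1) * k ^ (n - 1)))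
       \<and> S \<alpha>1 (- 2 * \<alpha>1 - \<alpha>2) (\<alpha>1 + \<alpha>2 + \<alpha>3) \<sim>[at_top]
           (\<lambda>n. Gamma (real n + 2 * a - b) / (Gamma (a + 1) * Gamma (a - b + 1) * k ^ (n - 1)))"
proof -
  \<comment> \<open>Gamma(x + 1) has its poles at x = -1, -2, ..., exactly the excluded
    values.\<close>
  have nonpole: "x + 1 \<notin> \<int>\<^sub>\<le>\<^sub>0" if "\<forall>m::nat. m \<ge> 1 \<longrightarrow> x \<noteq> - real m" for x :: real
  proof
    assume "x + 1 \<in> \<int>\<^sub>\<le>\<^sub>0"
    then obtain m where "x + 1 = - real m" by (auto elim: nonpos_Ints_cases')
    then show False using that[rule_format, of "Suc m"] by simp
  qed
  have a1: "a + 1 \<notin> \<int>\<^sub>\<le>\<^sub>0" and ab1: "a - b + 1 \<notin> \<int>\<^sub>\<le>\<^sub>0"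
    by (rule nonpole; fact assms)+
  have rhs: "(\<lambda>n. \<alpha>1 ^ (n - 1) * (Gamma (real n + (2 * a - b)) / (Gamma (a + 1) * Gamma (a - b + 1))))
      = (\<lambda>n. Gamma (real n + 2 * a - b) / (Gamma (a + 1) * Gamma (a - b + 1) * k ^ (n - 1)))"
    using assms(1,2) by (simp add: power_divide add_diff_eq mult_ac)
  have "S \<alpha>1 \<alpha>2 \<alpha>3 \<sim>[at_top]
      (\<lambda>n. \<alpha>1 ^ (n - 1) * (Gamma (real n + (2 * a - b)) / (Gamma (a + 1) * Gamma (a - b + 1))))"
    using assms a1 ab1 by (intro S_asymp_equiv)
  \<comment> \<open>Passing to the reciprocal sequence is the substitution \<open>(a, b) \<mapsto> (a - b, - b)\<close>, which
    fixes \<open>2 * a - b\<close> and swaps \<open>a\<close> with \<open>a - b\<close>.\<close>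
  moreover have "S \<alpha>1 (- 2 * \<alpha>1 - \<alpha>2) (\<alpha>1 + \<alpha>2 + \<alpha>3) \<sim>[at_top]
      (\<lambda>n. \<alpha>1 ^ (n - 1) * (Gamma (real n + (2 * (a - b) - (- b)))
              / (Gamma (a - b + 1) * Gamma (a - b - (- b) + 1))))"
  proof (rule S_asymp_equiv)
    show "a - b = (\<alpha>1 + \<alpha>2 + \<alpha>3) / \<alpha>1" "- b = - 1 - (- 2 * \<alpha>1 - \<alpha>2) / \<alpha>1"
      using assms(1) unfolding assms(3,4) by (simp_all add: field_simps)
    show "a - b - (- b) + 1 \<notin> \<int>\<^sub>\<le>\<^sub>0" using a1 by simp
  qed fact+
  moreover have "2 * (a - b) - (- b) = 2 * a - b" "a - b - (- b) = a" by simp_all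
  ultimately show ?thesis
    unfolding rhs [symmetric] by (simp only: mult.commute [of "Gamma (a - b + 1)"] simp_thms)
qed

end
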